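(* Let $r\ge 1$, $N\in\mathbf\Pi_{1,r}$, $a\in\mathbb R$ and $\lambda\in\mathbb R^r$. The following statements are equivalent: (i) $\lambda^\top z+a>0$ for all $z\in\mathcal Z_r(N)$. (ii) $\begin{bmatrix}-\lambda^{\top}N_{22}^{-1}N_{21}+a & \lambda^{\top}(N|N_{22})^{\frac12}\\ (N|N_{22})^{\frac12}\lambda & (\lambda^{\top}N_{22}^{-1}N_{21}-a)N_{22}\end{bmatrix}>0$. (iii) There exists a scalar $\beta>0$ such that $$\begin{bmatrix}-\lambda^{\top}N_{22}^{-1}N_{21}+a-\beta & \lambda^{\top}(N|N_{22})^{\frac12}\\ (N|N_{22})^{\frac12}\lambda & (\lambda^{\top}N_{22}^{-1}N_{21}-a)N_{22}\end{bmatrix}\ge 0.$$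
   Context: $\mathbb S^{k}$ is the space of real symmetric $k\times k$ matrices; $>0$, $\ge 0$, $<0$ denote positive definite, positive semidefinite, negative definite. A matrix $\Pi\in\mathbb S^{1+r}$ is partitioned as $\Pi=\begin{bmatrix}\Pi_{11}&\Pi_{12}\\ \Pi_{21}&\Pi_{22}\end{bmatrix}$ with $\Pi_{11}\in\mathbb R$, $\Pi_{22}\in\mathbb S^r$. When $\Pi_{22}$ is invertible, $\Pi|\Pi_{22}:=\Pi_{11}-\Pi_{12}\Pi_{22}^{-1}\Pi_{21}\in\mathbb R$ is the Schur complement. Define $$\mathcal Z_r(\Pi)=\left\{z\in\mathbb R^r\ \middle|\ \begin{bmatrix}1 \\ z\end{bmatrix}^\top\Pi\begin{bmatrix}1 \\ z\end{bmatrix}\ge 0\right\},\qquad \mathbf\Pi_{1,r}=\left\{\Pi\in\mathbb S^{1+r}\ \middle|\ \Pi_{22}<0\text{ and }\Pi|\Pi_{22}\ge 0\right\}.$$ *)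

theory Defs
  imports "HOL-Analysis.Analysis"
begin

text \<open>
  The space of real symmetric \<open>k \<times> k\<close> matrices is \<open>{A. symmetric_matrix A}\<close>; (semi)definiteness
  is a property of symmetric matrices only, so symmetry is part of each definition below.
\<close>

definition symmetric_matrix :: "real^'n^'n \<Rightarrow> bool"
  where "symmetric_matrix A \<longleftrightarrow> transpose A = A"

definition pos_definite :: "real^'n^'n \<Rightarrow> bool"
  where "pos_definite A \<longleftrightarrow> symmetric_matrix A \<and> (\<forall>x. x \<noteq> 0 \<longrightarrow> x \<bullet> (A *v x) > 0)"

definition pos_semidefinite :: "real^'n^'n \<Rightarrow> bool"
  where "pos_semidefinite A \<longleftrightarrow> symmetric_matrix A \<and> (\<forall>x. x \<bullet> (A *v x) \<ge> 0)"

definition neg_definite :: "real^'n^'n \<Rightarrow> bool"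
  where "neg_definite A \<longleftrightarrow> symmetric_matrix A \<and> (\<forall>x. x \<noteq> 0 \<longrightarrow> x \<bullet> (A *v x) < 0)"

text \<open>
  Matrices of size \<open>1 + r\<close> are indexed by \<open>unit + 'r\<close>, with \<open>r = CARD('r)\<close>; \<open>Inl ()\<close> is the first
  index. The \<open>1 \<times> 1\<close> block is a scalar, and the \<open>1 \<times> r\<close> and \<open>r \<times> 1\<close> blocks are vectors, so a product
  of a row with a column becomes an inner product.
\<close>

type_synonym 'r bordered = "real^(unit + 'r)^(unit + 'r)"

definition block11 :: "'r::finite bordered \<Rightarrow> real"
  where "block11 P = P $ Inl () $ Inl ()"

definition block12 :: "'r::finite bordered \<Rightarrow> real^'r"
  where "block12 P = (\<chi> j. P $ Inl () $ Inr j)"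

definition block21 :: "'r::finite bordered \<Rightarrow> real^'r"
  where "block21 P = (\<chi> i. P $ Inr i $ Inl ())"

definition block22 :: "'r::finite bordered \<Rightarrow> real^'r^'r"
  where "block22 P = (\<chi> i j. P $ Inr i $ Inr j)"

definition block_matrix :: "real \<Rightarrow> real^'r \<Rightarrow> real^'r \<Rightarrow> real^'r^'r \<Rightarrow> 'r::finite bordered"
  where "block_matrix p u v D =
    (\<chi> i j. case (i, j) of
        (Inl _, Inl _) \<Rightarrow> p
      | (Inl _, Inr l) \<Rightarrow> u $ l
      | (Inr k, Inl _) \<Rightarrow> v $ k
      | (Inr k, Inr l) \<Rightarrow> D $ k $ l)"

definition block_vector :: "real \<Rightarrow> real^'r \<Rightarrow> real^(unit + 'r::finite)"
  where "block_vector t z = (\<chi> i. case i of Inl _ \<Rightarrow> t | Inr k \<Rightarrow> z $ k)"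

text \<open>Only meaningful when the lower right block is invertible, as \<^const>\<open>matrix_inv\<close> is a choice.\<close>

definition schur_complement :: "'r::finite bordered \<Rightarrow> real"
  where "schur_complement P =
    block11 P - block12 P \<bullet> (matrix_inv (block22 P) *v block21 P)"

definition Z_set :: "'r::finite bordered \<Rightarrow> (real^'r) set"
  where "Z_set P = {z. block_vector 1 z \<bullet> (P *v block_vector 1 z) \<ge> 0}"

definition Pi_set :: "'r::finite bordered set"
  where "Pi_set = {P. symmetric_matrix P \<and> neg_definite (block22 P) \<and> schur_complement P \<ge> 0}"

end

theory Submission
  imports Defs
begin

text \<open>
  Put \<open>z\<^sub>0 = - N\<^sub>2\<^sub>2\<^sup>-\<^sup>1 N\<^sub>2\<^sub>1\<close>, \<open>c = \<lambda>\<^sup>T z\<^sub>0 + a\<close> and \<open>s = N|N\<^sub>2\<^sub>2\<close>. Completing the square, \<open>\<Z>\<^sub>r(N)\<close> is the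
  ellipsoid of all \<open>z\<^sub>0 + w\<close> with \<open>q(w) = - w\<^sup>T N\<^sub>2\<^sub>2 w \<le> s\<close>, and the form of the matrix in (ii) is
  \<open>c t\<^sup>2 + 2 t \<surd>s \<lambda>\<^sup>T w + c q(w)\<close>. Evaluating (i) at the boundary points
  \<open>w \<mapsto> \<plusminus>\<surd>(s / q(w)) w\<close> bounds the mixed term, and conversely (ii) at \<open>t = \<surd>s\<close> gives (i).
  The \<open>\<beta>\<close> in (iii) is the Schur complement of the lower right block in (ii).
\<close>

section \<open>Bordered matrices and their quadratic forms\<close>

lemma sum_UNIV_bordered:
  "(\<Sum>i\<in>UNIV. f i) = f (Inl ()) + (\<Sum>k\<in>UNIV. f (Inr k))"
  for f :: "unit + 'r::finite \<Rightarrow> 'b::comm_monoid_add"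
  by (simp add: UNIV_Plus_UNIV[symmetric] sum.Plus UNIV_unit del: UNIV_Plus_UNIV)

lemma block_vector_nth [simp]:
  "block_vector t z $ Inl u = t" "block_vector t z $ Inr k = z $ k"
  by (simp_all add: block_vector_def)

lemma block_matrix_nth [simp]:
  "block_matrix p u v D $ Inl x $ Inl y = p"
  "block_matrix p u v D $ Inl x $ Inr l = u $ l"
  "block_matrix p u v D $ Inr k $ Inl y = v $ k"
  "block_matrix p u v D $ Inr k $ Inr l = D $ k $ l"
  by (simp_all add: block_matrix_def)

lemma vec_bordered_eq_iff:
  "x = y \<longleftrightarrow> x $ Inl () = y $ Inl () \<and> (\<forall>k. x $ Inr k = y $ Inr k)"
  for x y :: "'b^(unit + 'r::finite)"
  by (simp add: vec_eq_iff split_sum_all)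

lemma block_vector_eq_0_iff [simp]: "block_vector t z = 0 \<longleftrightarrow> t = 0 \<and> z = 0"
  by (simp add: vec_bordered_eq_iff) (simp add: vec_eq_iff)

lemma block_vector_cases:
  obtains t z where "x = block_vector t z"
proof
  show "x = block_vector (x $ Inl ()) (\<chi> k. x $ Inr k)"
    by (simp add: vec_bordered_eq_iff)
qed

lemma inner_block_vector [simp]:
  "block_vector t z \<bullet> block_vector t' z' = t * t' + z \<bullet> z'"
  by (simp add: inner_vec_def sum_UNIV_bordered)

lemma block_matrix_mult_block_vector:
  "block_matrix p u v D *v block_vector t z = block_vector (p * t + u \<bullet> z) (t *\<^sub>R v + D *v z)"
  by (simp add: vec_bordered_eq_iff matrix_vector_mult_def sum_UNIV_bordered inner_vec_def)

lemma block_matrix_blocks: "block_matrix (block11 P) (block12 P) (block21 P) (block22 P) = P"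
  by (simp add: vec_bordered_eq_iff block11_def block12_def block21_def block22_def)

lemma symmetric_matrix_iff: "symmetric_matrix A \<longleftrightarrow> (\<forall>i j. A $ i $ j = A $ j $ i)"
  by (auto simp: symmetric_matrix_def transpose_def vec_eq_iff)

lemma symmetric_block_matrix [simp]:
  "symmetric_matrix (block_matrix p u u D) \<longleftrightarrow> symmetric_matrix D"
  by (auto simp: symmetric_matrix_iff split_sum_all)

lemma symmetric_matrix_scaleR: "symmetric_matrix A \<Longrightarrow> symmetric_matrix (c *\<^sub>R A)"
  by (simp add: symmetric_matrix_iff)

lemma symmetric_matrix_inner:
  "symmetric_matrix A \<Longrightarrow> x \<bullet> (A *v y) = y \<bullet> (A *v x)"
  by (metis symmetric_matrix_def dot_lmul_matrix inner_commute transpose_matrix_vector)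

lemma symmetric_block_vectors: "symmetric_matrix P \<Longrightarrow> block12 P = block21 P"
  by (simp add: symmetric_matrix_iff block12_def block21_def)

lemma block_matrix_quadratic_form:
  "block_vector t z \<bullet> (block_matrix p u u D *v block_vector t z)
     = p * t\<^sup>2 + 2 * t * (u \<bullet> z) + z \<bullet> (D *v z)"
  by (simp add: block_matrix_mult_block_vector inner_commute algebra_simps power2_eq_square)

text \<open>Every vector over the bordered index type is a \<open>block_vector\<close>, so
  definiteness turns into an inequality in a scalar \<open>t\<close> and a vector
  \<open>z\<close>.\<close>

lemma pos_definite_block_matrix_iff:
  "pos_definite (block_matrix p u u D) \<longleftrightarrow> symmetric_matrix D \<and>
     (\<forall>t z. t \<noteq> 0 \<or> z \<noteq> 0 \<longrightarrow> 0 < p * t\<^sup>2 + 2 * t * (u \<bullet> z) + z \<bullet> (D *v z))"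
  unfolding pos_definite_def symmetric_block_matrix
  by (metis block_vector_cases block_vector_eq_0_iff block_matrix_quadratic_form)

lemma pos_semidefinite_block_matrix_iff:
  "pos_semidefinite (block_matrix p u u D) \<longleftrightarrow> symmetric_matrix D \<and>
     (\<forall>t z. 0 \<le> p * t\<^sup>2 + 2 * t * (u \<bullet> z) + z \<bullet> (D *v z))"
  unfolding pos_semidefinite_def symmetric_block_matrix
  by (metis block_vector_cases block_matrix_quadratic_form)

section \<open>Negative definite blocks and the ellipsoid \<open>Z_set\<close>\<close>

text \<open>A kernel vector makes the form vanish, so the kernel is trivial and \<open>A\<close> is
  invertible. Invertibility is what makes the choice in \<open>matrix_inv\<close> an actual
  inverse.\<close>

lemma neg_definite_mult_matrix_inv:
  assumes "neg_definite A"
  shows "A *v (matrix_inv A *v y) = y"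
proof -
  have "x = 0" if "A *v x = 0" for x
    using assms that by (force simp: neg_definite_def)
  then have "invertible A"
    by (simp add: invertible_left_inverse matrix_left_invertible_ker)
  then have "A ** matrix_inv A = mat 1"
    unfolding invertible_def matrix_inv_def by (rule someI2_ex) simp
  then show ?thesis
    by (simp add: matrix_vector_mul_assoc)
qed

lemma neg_definite_nonpos: "neg_definite A \<Longrightarrow> x \<bullet> (A *v x) \<le> 0"
  by (cases "x = 0") (auto simp: neg_definite_def less_imp_le)

lemma Z_set_center_iff:
  assumes "symmetric_matrix P" and "neg_definite (block22 P)"
  shows "w - matrix_inv (block22 P) *v block21 P \<in> Z_set P
           \<longleftrightarrow> - (w \<bullet> (block22 P *v w)) \<le> schur_complement P"
proof -
  define D b y where "D = block22 P" and "b = block21 P" and "y = matrix_inv D *v b"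
  have Dy: "D *v y = b"
    using assms(2) unfolding y_def D_def by (rule neg_definite_mult_matrix_inv)
  have Dw: "y \<bullet> (D *v w) = w \<bullet> b"
    using symmetric_matrix_inner[of D y w] assms(2) by (simp add: neg_definite_def D_def[symmetric] Dy)
  have "P = block_matrix (block11 P) b b D"
    using block_matrix_blocks[of P] symmetric_block_vectors[OF assms(1)] by (simp add: b_def D_def)
  then have "block_vector 1 (w - y) \<bullet> (P *v block_vector 1 (w - y))
      = block11 P + 2 * (b \<bullet> (w - y)) + (w - y) \<bullet> (D *v (w - y))"
    using block_matrix_quadratic_form[of 1 "w - y" "block11 P" b D] by simp
  \<comment> \<open>The terms linear in \<open>w\<close> cancel, since
    \<open>w \<bullet> (D *v y)\<close> and \<open>y \<bullet> (D *v w)\<close> both equal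
    \<open>w \<bullet> b\<close>.\<close>
  also have "\<dots> = block11 P - b \<bullet> y + w \<bullet> (D *v w)"
    by (simp add: matrix_vector_mult_diff_distrib inner_diff_left inner_diff_right Dy Dw inner_commute)
  also have "block11 P - b \<bullet> y = schur_complement P"
    using symmetric_block_vectors[OF assms(1)] by (simp add: schur_complement_def b_def y_def D_def)
  finally show ?thesis
    by (auto simp: Z_set_def y_def b_def D_def)
qed

text \<open>Translating the center of the ellipsoid to the origin moves the value of the affine
  function at the center into its constant term.\<close>

lemma Z_set_affine_pos_iff:
  assumes "symmetric_matrix P" and "neg_definite (block22 P)"
  shows "(\<forall>z\<in>Z_set P. l \<bullet> z + a > 0) \<longleftrightarrow>
    (\<forall>w. - (w \<bullet> (block22 P *v w)) \<le> schur_complement P \<longrightarrow>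
      0 < l \<bullet> w + (a - l \<bullet> (matrix_inv (block22 P) *v block21 P)))"
proof -
  let ?y = "matrix_inv (block22 P) *v block21 P"
  have "(\<forall>z\<in>Z_set P. l \<bullet> z + a > 0) \<longleftrightarrow> (\<forall>w. w - ?y \<in> Z_set P \<longrightarrow> l \<bullet> (w - ?y) + a > 0)"
    by (metis diff_add_cancel add_diff_cancel)
  then show ?thesis
    by (simp add: Z_set_center_iff[OF assms] inner_diff_right algebra_simps)
qed

section \<open>Positivity on the ellipsoid, positivity of the form, and the margin
  \<open>\<beta>\<close>\<close>

lemma ellipsoid_pos_imp_form_pos:
  fixes D :: "real^'r^'r"
  assumes D: "neg_definite D" and s: "0 \<le> s"
    and pos: "\<And>w. - (w \<bullet> (D *v w)) \<le> s \<Longrightarrow> 0 < l \<bullet> w + c"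
    and nz: "t \<noteq> 0 \<or> w \<noteq> 0"
  shows "0 < c * t\<^sup>2 + 2 * t * (sqrt s * (l \<bullet> w)) - c * (w \<bullet> (D *v w))"
proof (cases "w = 0")
  case True
  then show ?thesis using pos[of 0] nz s by simp
next
  case False
  define q where "q = - (w \<bullet> (D *v w))"
  have q: "0 < q" and c: "0 < c"
    using D False pos[of 0] s by (simp_all add: q_def neg_definite_def)
  \<comment> \<open>This scaling puts \<open>k *\<^sub>R w\<close> and its negative on the boundary
    of the ellipsoid. For \<open>s = 0\<close> both are the center, and the bound below reads
    \<open>0 < c * sqrt q\<close>.\<close>
  define k where "k = sqrt s / sqrt q"
  have k2: "k * k * q = s"
    using q s by (simp add: k_def field_simps)
  have "- ((e *\<^sub>R w) \<bullet> (D *v (e *\<^sub>R w))) = e * e * q" for e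
    by (simp add: q_def matrix_vector_mult_scaleR)
  then have "0 < e * (l \<bullet> w) + c" if "e * e * q = s" for e
    using pos[of "e *\<^sub>R w"] that by simp
  from this[of k] this[of "- k"] k2 have "0 < k * (l \<bullet> w) + c" "0 < - k * (l \<bullet> w) + c"
    by simp_all
  then have "k * \<bar>l \<bullet> w\<bar> < c"
    by (simp add: abs_if)
  then have bound: "sqrt s * \<bar>l \<bullet> w\<bar> < c * sqrt q"
    using q by (simp add: k_def field_simps)
  have form: "c * t\<^sup>2 + 2 * t * (sqrt s * (l \<bullet> w)) + c * q > 0"
  proof (cases "t = 0")
    case True
    then show ?thesis using q c by simp
  next
    case False
    have "- (t * (sqrt s * (l \<bullet> w))) \<le> \<bar>t\<bar> * (sqrt s * \<bar>l \<bullet> w\<bar>)"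
      using s by (metis abs_ge_minus_self abs_mult abs_of_nonneg real_sqrt_ge_zero)
    also have "\<dots> < \<bar>t\<bar> * (c * sqrt q)"
      using bound False by simp
    \<comment> \<open>The mixed term exceeds \<open>- 2 * c * \<bar>t\<bar> * sqrt q\<close>, the
      cross term of the square on the left.\<close>
    finally have "c * (\<bar>t\<bar> - sqrt q)\<^sup>2 < c * t\<^sup>2 + 2 * t * (sqrt s * (l \<bullet> w)) + c * q"
      using q by (simp add: power2_diff algebra_simps)
    moreover have "0 \<le> c * (\<bar>t\<bar> - sqrt q)\<^sup>2"
      using c by simp
    ultimately show ?thesis by linarith
  qed
  then show ?thesis by (simp add: q_def)
qed

lemma form_pos_imp_ellipsoid_pos:
  fixes D :: "real^'r^'r"
  assumes D: "neg_definite D" and s: "0 \<le> s"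
    and pos: "\<And>t w. t \<noteq> 0 \<or> w \<noteq> 0 \<Longrightarrow>
      0 < c * t\<^sup>2 + 2 * t * (sqrt s * (l \<bullet> w)) - c * (w \<bullet> (D *v w))"
    and w: "- (w \<bullet> (D *v w)) \<le> s"
  shows "0 < l \<bullet> w + c"
proof -
  have c: "0 < c" using pos[of 1 0] by simp
  show ?thesis
  proof (cases "s = 0")
    case True
    \<comment> \<open>For \<open>s = 0\<close> the ellipsoid is a single point. This case is split
      off because the other one divides by \<open>s\<close>.\<close>
    then have "w = 0" using w D by (force simp: neg_definite_def)
    then show ?thesis using c by simp
  next
    case False
    \<comment> \<open>With \<open>t = sqrt s\<close> the form is at most
      \<open>2 * s * (l \<bullet> w + c)\<close> on the ellipsoid.\<close>
    have mixed: "2 * sqrt s * (sqrt s * (l \<bullet> w)) = 2 * s * (l \<bullet> w)"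
      using s by simp
    have "0 < c * s + 2 * s * (l \<bullet> w) - c * (w \<bullet> (D *v w))"
      using pos[of "sqrt s" w] False s unfolding mixed by simp
    moreover have "c * - (w \<bullet> (D *v w)) \<le> c * s"
      using w c by (intro mult_left_mono) simp_all
    ultimately have "0 < s * (l \<bullet> w + c)" by (simp add: algebra_simps)
    then show ?thesis using s by (simp add: zero_less_mult_iff)
  qed
qed

text \<open>At \<open>t = 1\<close> a positive form attains a positive minimum over
  \<open>w\<close>, and this minimum can serve as \<open>\<beta>\<close>. Conversely,
  \<open>\<beta> * t\<^sup>2\<close> gives strictness when \<open>t \<noteq> 0\<close>, and negative
  definiteness of \<open>D\<close> gives it when \<open>t = 0\<close>.\<close>

lemma form_pos_iff_exists_margin:
  fixes D :: "real^'r^'r"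
  assumes D: "neg_definite D"
  shows "(\<forall>t w. t \<noteq> 0 \<or> w \<noteq> 0 \<longrightarrow> 0 < c * t\<^sup>2 + 2 * t * (u \<bullet> w) - c * (w \<bullet> (D *v w)))
     \<longleftrightarrow> (\<exists>\<beta>>0. \<forall>t w. 0 \<le> (c - \<beta>) * t\<^sup>2 + 2 * t * (u \<bullet> w) - c * (w \<bullet> (D *v w)))"
    (is "?P \<longleftrightarrow> ?Q")
proof
  assume P: ?P
  have c: "0 < c" using P[rule_format, of 1 0] by simp
  define y where "y = matrix_inv D *v u"
  have Dy: "D *v y = u"
    using D unfolding y_def by (rule neg_definite_mult_matrix_inv)
  have yDw: "y \<bullet> (D *v w) = u \<bullet> w" for w
    using symmetric_matrix_inner[of D y w] D by (simp add: neg_definite_def Dy inner_commute)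
  \<comment> \<open>This is the Schur complement of the block \<open>- c *\<^sub>R D\<close>;
    subtracting it from the corner leaves the pure square in \<open>sq\<close>.\<close>
  define \<beta> where "\<beta> = c + (u \<bullet> y) / c"
  have sq: "(c - \<beta>) * t\<^sup>2 + 2 * t * (u \<bullet> w) - c * (w \<bullet> (D *v w))
      = - c * ((w - (t / c) *\<^sub>R y) \<bullet> (D *v (w - (t / c) *\<^sub>R y)))" for t w
    using c by (simp add: \<beta>_def matrix_vector_mult_diff_distrib matrix_vector_mult_scaleR
        inner_diff_left inner_diff_right Dy yDw inner_commute field_simps power2_eq_square)
  \<comment> \<open>At \<open>t = 1\<close> and \<open>w = (1 / c) *\<^sub>R y\<close> the square
    vanishes, so the form takes the value \<open>\<beta>\<close>.\<close>
  have "0 < \<beta>"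
    using P[rule_format, of 1 "(1 / c) *\<^sub>R y"] sq[of 1 "(1 / c) *\<^sub>R y"] by simp
  moreover have "0 \<le> - c * (x \<bullet> (D *v x))" for x
    using c neg_definite_nonpos[OF D, of x] by (simp add: mult_nonneg_nonpos)
  ultimately show ?Q using sq by metis
next
  assume ?Q
  then obtain \<beta> where \<beta>: "0 < \<beta>"
    and Q: "\<And>t w. 0 \<le> (c - \<beta>) * t\<^sup>2 + 2 * t * (u \<bullet> w) - c * (w \<bullet> (D *v w))"
    by blast
  have c: "0 < c" using Q[of 1 0] \<beta> by simp
  show ?P
  proof (intro allI impI)
    fix t :: real and w :: "real^'r"
    assume nz: "t \<noteq> 0 \<or> w \<noteq> 0"
    show "0 < c * t\<^sup>2 + 2 * t * (u \<bullet> w) - c * (w \<bullet> (D *v w))"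
    proof (cases "t = 0")
      case True
      then have "w \<bullet> (D *v w) < 0" using nz D by (simp add: neg_definite_def)
      then show ?thesis using True c by (simp add: mult_pos_neg)
    next
      case False
      then have "0 < \<beta> * t\<^sup>2" using \<beta> by simp
      then show ?thesis using Q[of t w] by (simp add: algebra_simps)
    qed
  qed
qed

section \<open>The equivalence of the three conditions\<close>

theorem theorem8:
  fixes N :: "real^(unit + 'r::finite)^(unit + 'r)"
    and a :: real
    and lam :: "real^'r"
  assumes "N \<in> Pi_set"
  shows
    "((\<forall>z \<in> Z_set N. lam \<bullet> z + a > 0) \<longleftrightarrow>
      pos_definite (block_matrix
        (- (lam \<bullet> (matrix_inv (block22 N) *v block21 N)) + a)
        (sqrt (schur_complement N) *\<^sub>R lam)
        (sqrt (schur_complement N) *\<^sub>R lam)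
        ((lam \<bullet> (matrix_inv (block22 N) *v block21 N) - a) *\<^sub>R block22 N)))
     \<and>
     (pos_definite (block_matrix
        (- (lam \<bullet> (matrix_inv (block22 N) *v block21 N)) + a)
        (sqrt (schur_complement N) *\<^sub>R lam)
        (sqrt (schur_complement N) *\<^sub>R lam)
        ((lam \<bullet> (matrix_inv (block22 N) *v block21 N) - a) *\<^sub>R block22 N)) \<longleftrightarrow>
      (\<exists>\<beta>>0. pos_semidefinite (block_matrix
        (- (lam \<bullet> (matrix_inv (block22 N) *v block21 N)) + a - \<beta>)
        (sqrt (schur_complement N) *\<^sub>R lam)
        (sqrt (schur_complement N) *\<^sub>R lam)
        ((lam \<bullet> (matrix_inv (block22 N) *v block21 N) - a) *\<^sub>R block22 N))))"
proof -
  define D s c where "D = block22 N" and "s = schur_complement N"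
    and "c = a - lam \<bullet> (matrix_inv D *v block21 N)"
  have symN: "symmetric_matrix N" and D: "neg_definite D" and s: "0 \<le> s"
    using assms by (simp_all add: Pi_set_def D_def s_def)
  let ?form = "\<lambda>p t w. p * t\<^sup>2 + 2 * t * (sqrt s * (lam \<bullet> w)) - c * (w \<bullet> (D *v w))"
  have sym: "symmetric_matrix ((- c) *\<^sub>R D)"
    using D by (intro symmetric_matrix_scaleR) (simp add: neg_definite_def)
  \<comment> \<open>One number \<open>c\<close>, the value of the affine function at the center,
    gives both the corner in (ii) and the factor \<open>- c\<close> of the lower right
    block.\<close>
  have coeffs: "- (lam \<bullet> (matrix_inv D *v block21 N)) + a = c"
    "lam \<bullet> (matrix_inv D *v block21 N) - a = - c"
    by (simp_all add: c_def)
  have i: "(\<forall>z \<in> Z_set N. lam \<bullet> z + a > 0) \<longleftrightarrow>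
      (\<forall>w. - (w \<bullet> (D *v w)) \<le> s \<longrightarrow> 0 < lam \<bullet> w + c)"
    using Z_set_affine_pos_iff[OF symN D[unfolded D_def], of lam a] by (simp add: D_def s_def c_def)
  have quad: "w \<bullet> (((- c) *\<^sub>R D) *v w) = - (c * (w \<bullet> (D *v w)))" for w
    by (simp only: scaleR_matrix_vector_assoc[symmetric] inner_scaleR_right mult_minus_left)
  have ii: "pos_definite (block_matrix c (sqrt s *\<^sub>R lam) (sqrt s *\<^sub>R lam) ((- c) *\<^sub>R D))
      \<longleftrightarrow> (\<forall>t w. t \<noteq> 0 \<or> w \<noteq> 0 \<longrightarrow> 0 < ?form c t w)"
    using sym by (simp add: pos_definite_block_matrix_iff quad del: scaleR_minus_left)
  have iii: "pos_semidefinite (block_matrix (c - \<beta>) (sqrt s *\<^sub>R lam) (sqrt s *\<^sub>R lam) ((- c) *\<^sub>R D))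
      \<longleftrightarrow> (\<forall>t w. 0 \<le> ?form (c - \<beta>) t w)" for \<beta>
    using sym by (simp add: pos_semidefinite_block_matrix_iff quad del: scaleR_minus_left)
  have "(\<forall>w. - (w \<bullet> (D *v w)) \<le> s \<longrightarrow> 0 < lam \<bullet> w + c)
      \<longleftrightarrow> (\<forall>t w. t \<noteq> 0 \<or> w \<noteq> 0 \<longrightarrow> 0 < ?form c t w)"
    using ellipsoid_pos_imp_form_pos[OF D s] form_pos_imp_ellipsoid_pos[OF D s] by blast
  moreover have "(\<forall>t w. t \<noteq> 0 \<or> w \<noteq> 0 \<longrightarrow> 0 < ?form c t w)
      \<longleftrightarrow> (\<exists>\<beta>>0. \<forall>t w. 0 \<le> ?form (c - \<beta>) t w)"
    \<comment> \<open>The off-diagonal vector \<open>sqrt s *\<^sub>R lam\<close> plays the part of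
      \<open>u\<close>.\<close>
    using form_pos_iff_exists_margin[OF D, of c "sqrt s *\<^sub>R lam"] by simp
  ultimately show ?thesis
    unfolding D_def[symmetric] s_def[symmetric] coeffs i ii iii by (rule conjI)
qed

end
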